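(* Let $\mathcal{H}=\mathcal{H}^\dagger$ be a non-negative (positive semidefinite) linear operator on $\mathbb{C}^d$, $d\ge2$, with non-degenerate smallest eigenvalue $0$ with unit eigenvector $|\psi\rangle$, and spectral gap $\Delta>0$. Let $|\phi\rangle\in\mathbb{C}^d$ be a unit vector such that $\langle\phi|\mathcal{H}|\phi\rangle<\Delta$. Then $$1-\frac{\langle\phi|\mathcal{H}|\phi\rangle}{\Delta}\;\le\;|\langle\phi|\psi\rangle|^2\;\le\;1-\frac{\langle\phi|\mathcal{H}|\phi\rangle}{\mathrm{Tr}\,\mathcal{H}}.$$
   Context: The spectral gap $\Delta$ is the difference between the second smallest and the smallest eigenvalue; here it equals the smallest nonzero eigenvalue of $\mathcal{H}$. *)

theory Defs
  imports
    "Jordan_Normal_Form.Schur_Decomposition"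
    "Jordan_Normal_Form.Matrix_Kernel"
begin

text \<open>The inner product of the underlying library is linear in its first argument; the bracket
  below is conjugate-linear in the first argument.\<close>

definition braket :: "complex vec \<Rightarrow> complex vec \<Rightarrow> complex" where
  "braket u v = v \<bullet>c u"

definition unit_vector :: "nat \<Rightarrow> complex vec \<Rightarrow> bool" where
  "unit_vector d v \<longleftrightarrow> v \<in> carrier_vec d \<and> braket v v = 1"

definition self_adjoint :: "complex mat \<Rightarrow> bool" where
  "self_adjoint A \<longleftrightarrow> square_mat A \<and> mat_adjoint A = A"

text \<open>The order on the complex numbers is the one of \<open>HOL-Library.Complex_Order\<close>, where \<open>0 \<le> z\<close>
  means that \<open>z\<close> is real and non-negative.\<close>

definition positive_semidefinite :: "complex mat \<Rightarrow> bool" where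
  "positive_semidefinite A \<longleftrightarrow> (\<forall>v \<in> carrier_vec (dim_row A). 0 \<le> braket v (A *\<^sub>v v))"

text \<open>For self-adjoint operators, the only ones considered, the eigenvalues, the expectation values
  and the trace are real, so that \<open>Re\<close> in the following definitions is a mere change of type.\<close>

definition expectation :: "complex mat \<Rightarrow> complex vec \<Rightarrow> real" where
  "expectation A v = Re (braket v (A *\<^sub>v v))"

definition mat_trace :: "complex mat \<Rightarrow> real" where
  "mat_trace A = Re (\<Sum>i<dim_row A. A $$ (i, i))"

text \<open>The eigenvalues in increasing order, repeated according to multiplicity.\<close>

definition sorted_eigenvalues :: "complex mat \<Rightarrow> real list" where
  "sorted_eigenvalues A = sorted_list_of_multiset (image_mset Re (proots (char_poly A)))"

definition smallest_eigenvalue :: "complex mat \<Rightarrow> real" where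
  "smallest_eigenvalue A = sorted_eigenvalues A ! 0"

definition second_smallest_eigenvalue :: "complex mat \<Rightarrow> real" where
  "second_smallest_eigenvalue A = sorted_eigenvalues A ! 1"

definition spectral_gap :: "complex mat \<Rightarrow> real" where
  "spectral_gap A = second_smallest_eigenvalue A - smallest_eigenvalue A"

text \<open>\<open>char_matrix A e\<close> is \<open>A - e I\<close>, so its kernel is the eigenspace of \<open>e\<close>.\<close>

definition nondegenerate_eigenvalue :: "complex mat \<Rightarrow> complex \<Rightarrow> bool" where
  "nondegenerate_eigenvalue A e \<longleftrightarrow> kernel_dim (char_matrix A e) = 1"

end

theory Submission
  imports Defs
begin

text \<open>In an orthonormal eigenbasis of \<open>H\<close> with eigenvalues \<open>0 = e 0 < \<Delta> = e 1 \<le> e 2 \<le> \<dots>\<close>, let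
  \<open>w i\<close> be the squared moduli of the coordinates of \<open>\<phi>\<close>, so that \<open>\<Sum>i. w i = 1\<close>, the expectation
  of \<open>H\<close> is \<open>\<Sum>i. e i * w i\<close>, and \<open>w 0\<close> is the squared overlap with \<open>\<psi>\<close>. For \<open>i > 0\<close> each \<open>e i\<close>
  lies between \<open>\<Delta>\<close> and the trace, so the expectation lies between \<open>\<Delta> * (1 - w 0)\<close> and
  \<open>Tr H * (1 - w 0)\<close>.\<close>

section \<open>Adjoints and traces of matrices\<close>

lemma mat_adjoint_carrier [simp]:
  "A \<in> carrier_mat m n \<Longrightarrow> mat_adjoint A \<in> carrier_mat n m"
  by (auto simp: mat_adjoint_def mat_of_rows_def)

lemma dim_mat_adjoint [simp]:
  "dim_row (mat_adjoint A) = dim_col A" "dim_col (mat_adjoint A) = dim_row A"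
  by (auto simp: mat_adjoint_def mat_of_rows_def)

lemma index_mat_adjoint [simp]:
  "i < dim_col A \<Longrightarrow> j < dim_row A \<Longrightarrow> mat_adjoint A $$ (i, j) = conjugate (A $$ (j, i))"
  by (auto simp: mat_adjoint_def mat_of_rows_def)

lemma mat_adjoint_mat_adjoint [simp]: "mat_adjoint (mat_adjoint A) = A"
  by (rule eq_matI) auto

lemma mat_adjoint_mult:
  assumes "A \<in> carrier_mat m n" "B \<in> carrier_mat n k"
  shows "mat_adjoint (A * B) = mat_adjoint B * mat_adjoint A"
  using assms
  by (intro eq_matI)
     (auto simp: scalar_prod_def sum_conjugate conjugate_dist_mul mult.commute intro!: sum.cong)

lemma mult_mat_vec_cscalar_prod:
  fixes A :: "'a :: conjugatable_field mat"
  assumes "A \<in> carrier_mat m n" "u \<in> carrier_vec n" "v \<in> carrier_vec m"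
  shows "(A *\<^sub>v u) \<bullet>c v = u \<bullet>c (mat_adjoint A *\<^sub>v v)"
proof -
  have "(A *\<^sub>v u) \<bullet>c v = (\<Sum>i<m. \<Sum>j<n. A $$ (i, j) * u $ j * conjugate (v $ i))"
    using assms by (auto simp: scalar_prod_def sum_distrib_right lessThan_atLeast0 intro!: sum.cong)
  also have "\<dots> = (\<Sum>j<n. \<Sum>i<m. A $$ (i, j) * u $ j * conjugate (v $ i))"
    by (rule sum.swap)
  also have "\<dots> = u \<bullet>c (mat_adjoint A *\<^sub>v v)"
    using assms
    by (auto simp: scalar_prod_def sum_distrib_left lessThan_atLeast0 sum_conjugate
        conjugate_dist_mul intro!: sum.cong)
  finally show ?thesis .
qed

lemma trace_mult_commute:
  fixes A B :: "'a :: comm_semiring_0 mat"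
  assumes "A \<in> carrier_mat m n" "B \<in> carrier_mat n m"
  shows "(\<Sum>i<m. (A * B) $$ (i, i)) = (\<Sum>i<n. (B * A) $$ (i, i))"
proof -
  have "(\<Sum>i<m. (A * B) $$ (i, i)) = (\<Sum>i<m. \<Sum>j<n. A $$ (i, j) * B $$ (j, i))"
    using assms by (auto simp: scalar_prod_def lessThan_atLeast0 intro!: sum.cong)
  also have "\<dots> = (\<Sum>j<n. \<Sum>i<m. A $$ (i, j) * B $$ (j, i))"
    by (rule sum.swap)
  also have "\<dots> = (\<Sum>i<n. (B * A) $$ (i, i))"
    using assms by (auto simp: scalar_prod_def lessThan_atLeast0 mult.commute intro!: sum.cong)
  finally show ?thesis .
qed


section \<open>Unitary diagonalization of self-adjoint matrices\<close>

text \<open>Complete \<open>v\<close> to a basis, orthogonalize it and normalize the columns;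
  \<open>c\<close> is the inverse norm of \<open>v\<close>. Applied to an eigenvector, this starts
  the deflation in the diagonalization below.\<close>

lemma unitary_with_first_col:
  fixes v :: "complex vec"
  assumes v: "v \<in> carrier_vec n" "v \<noteq> 0\<^sub>v n"
  obtains W c where "W \<in> carrier_mat n n" "mat_adjoint W * W = 1\<^sub>m n" "col W 0 = c \<cdot>\<^sub>v v"
proof -
  interpret cof_vec_space n "TYPE(complex)" .
  have n: "n > 0"
    using v by (cases n) auto
  define b where "b = basis_completion v"
  define ws where "ws = gram_schmidt n b"
  \<comment> \<open>\<open>gram_schmidt\<close> orthogonalizes without normalizing, so each column
    of \<open>W\<close> is divided by its norm \<open>a j\<close>.\<close>
  define a where "a j = complex_of_real (sqrt (Re (ws ! j \<bullet>c ws ! j)))" for j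
  define W where "W = mat n n (\<lambda>(i, j). ws ! j $ i / a j)"
  note b = basis_completion[OF v, folded b_def]
  note ws = gram_schmidt_result[OF b(2,4,5) ws_def]
  have len: "length ws = n"
    using ws b by simp
  \<comment> \<open>Gram-Schmidt leaves the head of its input unchanged, so \<open>v\<close>
    survives as the first vector.\<close>
  obtain vs where "b = v # vs"
    using b(6,7) n by (cases b) auto
  hence "hd ws = v"
    using v by (simp add: ws_def)
  hence ws0: "ws ! 0 = v"
    using len n by (cases ws) auto
  have wsc: "ws ! j \<in> carrier_vec n" if "j < n" for j
    using ws(3) len that nth_mem by blast
  have ws_pos: "Re (ws ! j \<bullet>c ws ! j) > 0 \<and> Im (ws ! j \<bullet>c ws ! j) = 0" if "j < n" for j
  proof -
    \<comment> \<open>Orthogonality in the sense of \<open>corthogonal\<close> includes that the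
      product of each vector with itself is nonzero.\<close>
    have "ws ! j \<bullet>c ws ! j \<noteq> 0"
      using corthogonalD[OF ws(2)] len that by auto
    thus ?thesis
      using conjugate_square_ge_0_vec[of "ws ! j"]
      by (auto simp: less_eq_complex_def complex_eq_iff)
  qed
  have a_sq: "a j * a j = ws ! j \<bullet>c ws ! j" if "j < n" for j
    using ws_pos[OF that]
    by (simp add: a_def complex_eq_iff flip: of_real_mult)
  have "mat_adjoint W * W = 1\<^sub>m n"
  proof (rule eq_matI)
    fix i j assume "i < dim_row (1\<^sub>m n :: complex mat)" "j < dim_col (1\<^sub>m n :: complex mat)"
    hence ij: "i < n" "j < n" by auto
    have "(mat_adjoint W * W) $$ (i, j) = (\<Sum>k<n. cnj (ws ! i $ k / a i) * (ws ! j $ k / a j))"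
      using ij by (simp add: W_def scalar_prod_def lessThan_atLeast0)
    also have "\<dots> = (\<Sum>k<n. ws ! j $ k * cnj (ws ! i $ k)) / (a i * a j)"
      unfolding sum_divide_distrib by (intro sum.cong) (auto simp: a_def)
    also have "(\<Sum>k<n. ws ! j $ k * cnj (ws ! i $ k)) = ws ! j \<bullet>c ws ! i"
      using carrier_vecD[OF wsc[OF ij(1)]] by (simp add: scalar_prod_def lessThan_atLeast0)
    also have "\<dots> / (a i * a j) = 1\<^sub>m n $$ (i, j)"
      using corthogonalD[OF ws(2), of j i] a_sq[of i] ij len by auto
    finally show "(mat_adjoint W * W) $$ (i, j) = 1\<^sub>m n $$ (i, j)" .
  qed (auto simp: W_def)
  moreover have "col W 0 = (1 / a 0) \<cdot>\<^sub>v v"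
    using n v by (auto simp: W_def ws0)
  moreover have "W \<in> carrier_mat n n"
    by (simp add: W_def)
  ultimately show ?thesis
    using that by blast
qed

lemma mult_four_block_diag:
  assumes "A1 \<in> carrier_mat nr1 n1" "D1 \<in> carrier_mat nr2 n2"
    and "A2 \<in> carrier_mat n1 nc1" "D2 \<in> carrier_mat n2 nc2"
  shows "four_block_mat A1 (0\<^sub>m nr1 n2) (0\<^sub>m nr2 n1) D1 *
      four_block_mat A2 (0\<^sub>m n1 nc2) (0\<^sub>m n2 nc1) D2 =
    four_block_mat (A1 * A2) (0\<^sub>m nr1 nc2) (0\<^sub>m nr2 nc1) (D1 * D2)"
  using assms
  by (subst mult_four_block_mat[of _ nr1 n1 _ n2 _ nr2 _ _ nc1 _ nc2]) auto

text \<open>The diagonal entries can be made to appear in any prescribed order; this is what allows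
  sorting them below.\<close>

theorem hermitian_unitary_diagonalization:
  fixes A :: "complex mat"
  assumes "A \<in> carrier_mat n n" "mat_adjoint A = A"
    and "char_poly A = (\<Prod>e\<leftarrow>es. [:- e, 1:])"
  shows "\<exists>P \<in> carrier_mat n n. mat_adjoint P * P = 1\<^sub>m n \<and>
           mat_adjoint P * A * P = mat_diag n ((!) es)"
  using assms
proof (induction es arbitrary: n A)
  case Nil
  hence "n = 0"
    using degree_monic_char_poly[of A n] by simp
  thus ?case
    by (intro bexI[of _ "1\<^sub>m 0"]) (auto simp: mat_diag_def)
next
  case (Cons e es n A)
  note A = Cons.prems(1)
  have "degree (char_poly A) = length (e # es)"
    using degree_linear_factors[of uminus "e # es"] Cons.prems(3) by simp
  hence n_eq: "n = Suc (length es)"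
    using degree_monic_char_poly[OF A] by simp
  define m where "m = length es"
  have n: "n = Suc m"
    by (simp add: n_eq m_def)
  \<comment> \<open>Deflation: the head of the prescribed list is split off first, and induction on
    the list handles the complement of its eigenvector. So the order of the list becomes the order
    on the diagonal.\<close>
  have "eigenvalue A e"
    unfolding eigenvalue_root_char_poly[OF A] Cons.prems(3) by simp
  then obtain v where v: "v \<in> carrier_vec n" "v \<noteq> 0\<^sub>v n" "A *\<^sub>v v = e \<cdot>\<^sub>v v"
    using A unfolding eigenvalue_def eigenvector_def by auto
  obtain W c where W: "W \<in> carrier_mat n n" and WW: "mat_adjoint W * W = 1\<^sub>m n"
    and col_W: "col W 0 = c \<cdot>\<^sub>v v"
    using unitary_with_first_col[OF v(1,2)] .
  define A' where "A' = mat_adjoint W * A * W"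
  have aW: "mat_adjoint W \<in> carrier_mat n n"
    using W by simp
  have A': "A' \<in> carrier_mat n n"
    using A W aW by (auto simp: A'_def)
  have herm: "mat_adjoint A' = A'"
    using A W aW Cons.prems(2)
    by (simp add: A'_def mat_adjoint_mult[of _ n n _ n] assoc_mult_mat[of _ n n _ n _ n])
  \<comment> \<open>A one-sided inverse of a square matrix is two-sided, so conjugation by
    \<open>W\<close> is a similarity and keeps the characteristic polynomial.\<close>
  have "W * mat_adjoint W = 1\<^sub>m n"
    using mat_mult_left_right_inverse[OF aW W WW] .
  hence sim: "similar_mat A' A"
    using A W aW WW by (intro similar_matI[of _ _ "mat_adjoint W" W n]) (auto simp: A'_def)
  \<comment> \<open>The first column of \<open>W\<close> is a multiple of the eigenvector
    \<open>v\<close>, and \<open>mat_adjoint W\<close> sends it to the first unit vector.\<close>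
  have "col A' 0 = mat_adjoint W *\<^sub>v (A *\<^sub>v col W 0)"
    unfolding A'_def assoc_mult_mat[OF aW A W]
    using n by (simp only: col_mult2[OF aW mult_carrier_mat[OF A W]] col_mult2[OF A W] zero_less_Suc)
  also have "A *\<^sub>v col W 0 = e \<cdot>\<^sub>v col W 0"
    using A v by (simp add: col_W mult_mat_vec[of _ n n] smult_smult_assoc mult.commute)
  also have "mat_adjoint W *\<^sub>v (e \<cdot>\<^sub>v col W 0) = e \<cdot>\<^sub>v col (mat_adjoint W * W) 0"
    using mult_mat_vec[OF aW col_carrier_vec[OF _ W]] n by (simp only: col_mult2[OF aW W] zero_less_Suc)
  finally have col0: "col A' 0 = e \<cdot>\<^sub>v unit_vec n 0"
    using n by (simp add: WW)
  have c0: "A' $$ (i, 0) = (if i = 0 then e else 0)" if "i < n" for i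
    using arg_cong[OF col0, of "\<lambda>x. x $ i"] A' n that by auto
  \<comment> \<open>Self-adjointness carries the zeros of the first column over to the first row,
    which makes \<open>A'\<close> block diagonal.\<close>
  have r0: "A' $$ (0, j) = (if j = 0 then e else 0)" if "j < n" for j
  proof (cases "j = 0")
    case True
    thus ?thesis using c0[of 0] n by simp
  next
    case False
    have "A' $$ (0, j) = mat_adjoint A' $$ (0, j)"
      by (simp add: herm)
    also have "\<dots> = 0"
      using A' n that False c0[of j] by simp
    finally show ?thesis using False by simp
  qed
  define A1 where "A1 = mat 1 1 (\<lambda>_. e)"
  define A3 where "A3 = mat m m (\<lambda>(i, j). A' $$ (Suc i, Suc j))"
  have A1: "A1 \<in> carrier_mat 1 1" and A3: "A3 \<in> carrier_mat m m"
    by (auto simp: A1_def A3_def)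
  have block: "A' = four_block_mat A1 (0\<^sub>m 1 m) (0\<^sub>m m 1) A3"
    by (rule eq_matI) (use A' n c0 r0 in \<open>auto simp: A1_def A3_def\<close>)
  have herm3: "mat_adjoint A3 = A3"
  proof (rule eq_matI)
    fix i j assume "i < dim_row A3" "j < dim_col A3"
    hence ij: "i < m" "j < m" by (auto simp: A3_def)
    have "mat_adjoint A' $$ (Suc i, Suc j) = A' $$ (Suc i, Suc j)"
      by (simp add: herm)
    thus "mat_adjoint A3 $$ (i, j) = A3 $$ (i, j)"
      using ij A' n by (simp add: A3_def)
  qed (auto simp: A3_def)
  have "char_poly A' = char_poly A1 * char_poly A3"
    unfolding block by (rule char_poly_four_block_zeros_col) (use A1 A3 in auto)
  moreover have "char_poly A1 = [:- e, 1:]"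
    by (simp add: A1_def char_poly_defs det_def sign_def)
  \<comment> \<open>Cancelling the common linear factor leaves exactly the tail \<open>es\<close>
    for the lower block, as the induction hypothesis requires.\<close>
  ultimately have "[:- e, 1:] * char_poly A3 = [:- e, 1:] * (\<Prod>e\<leftarrow>es. [:- e, 1:])"
    using char_poly_similar[OF sim] Cons.prems(3) by simp
  hence "char_poly A3 = (\<Prod>e\<leftarrow>es. [:- e, 1:])"
    by (metis mult_cancel_left pCons_eq_0_iff zero_neq_one)
  from Cons.IH[OF A3 herm3 this] obtain P3 where P3: "P3 \<in> carrier_mat m m"
    "mat_adjoint P3 * P3 = 1\<^sub>m m" "mat_adjoint P3 * A3 * P3 = mat_diag m ((!) es)" by blast
  \<comment> \<open>\<open>F\<close> fixes the first coordinate and acts as \<open>P3\<close> on the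
    others; the required unitary is \<open>W * F\<close>.\<close>
  define F where "F = four_block_mat (1\<^sub>m 1) (0\<^sub>m 1 m) (0\<^sub>m m 1) P3"
  have aF: "mat_adjoint F = four_block_mat (1\<^sub>m 1) (0\<^sub>m 1 m) (0\<^sub>m m 1) (mat_adjoint P3)"
    by (rule eq_matI) (use P3(1) in \<open>auto simp: F_def\<close>)
  have aP3: "mat_adjoint P3 \<in> carrier_mat m m"
    using P3 by simp
  have F: "F \<in> carrier_mat n n" and aF_carrier: "mat_adjoint F \<in> carrier_mat n n"
    using P3 n four_block_carrier_mat[of "1\<^sub>m 1" 1 1 P3 m m] by (auto simp: F_def)
  have FF: "mat_adjoint F * F = 1\<^sub>m n"
    unfolding aF unfolding F_def
    unfolding mult_four_block_diag[OF one_carrier_mat aP3 one_carrier_mat P3(1)]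
    by (simp only: P3(2) n four_block_one_mat plus_1_eq_Suc left_mult_one_mat[OF one_carrier_mat])
  have "mat_adjoint F * A' * F =
      four_block_mat A1 (0\<^sub>m 1 m) (0\<^sub>m m 1) (mat_adjoint P3 * A3 * P3)"
    unfolding aF block unfolding F_def
    unfolding mult_four_block_diag[OF one_carrier_mat aP3 A1 A3]
      mult_four_block_diag[OF mult_carrier_mat[OF one_carrier_mat A1] mult_carrier_mat[OF aP3 A3]
        one_carrier_mat P3(1)]
    using A1 by simp
  also have "\<dots> = mat_diag n ((!) (e # es))"
    unfolding P3(3) by (rule eq_matI) (auto simp: n A1_def mat_diag_def nth_Cons')
  finally have FAF: "mat_adjoint F * A' * F = mat_diag n ((!) (e # es))" .
  show ?case
  proof (intro bexI[of _ "W * F"] conjI)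
    show "W * F \<in> carrier_mat n n"
      using W F by simp
    have aWF: "mat_adjoint (W * F) = mat_adjoint F * mat_adjoint W"
      using W F by (rule mat_adjoint_mult)
    have "mat_adjoint (W * F) * (W * F) = mat_adjoint F * (mat_adjoint W * W * F)"
      unfolding aWF assoc_mult_mat[OF aF_carrier aW mult_carrier_mat[OF W F]]
        assoc_mult_mat[OF aW W F] ..
    thus "mat_adjoint (W * F) * (W * F) = 1\<^sub>m n"
      using F by (simp add: WW FF)
    have "mat_adjoint (W * F) * A * (W * F) = mat_adjoint F * A' * F"
      unfolding aWF A'_def using A W F aW aF_carrier
      by (simp add: assoc_mult_mat[of _ n n _ n _ n] mult_carrier_mat[of _ n n _ n])
    thus "mat_adjoint (W * F) * A * (W * F) = mat_diag n ((!) (e # es))"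
      by (simp add: FAF)
  qed
qed

section \<open>Diagonalization with the eigenvalues in increasing order\<close>

lemma proots_linear_factors: "proots (\<Prod>a\<leftarrow>as. [:- a, 1:]) = mset (as :: 'a :: idom list)"
proof (induction as)
  case (Cons a as)
  have "(\<Prod>a\<leftarrow>as. [:- a, 1:]) \<noteq> 0"
    by (auto simp: prod_list_zero_iff)
  from proots_mult[OF _ this, of "[:- a, 1:]"] show ?case
    by (simp add: Cons.IH del: mult_pCons_left)
qed simp

text \<open>The diagonalization is used twice: first with the roots in an arbitrary order, to see
  that they are real, then with the sorted list, which becomes available once taking real parts is
  known to lose nothing.\<close>

corollary hermitian_unitary_diagonalization_sorted:
  assumes A: "A \<in> carrier_mat n n" "mat_adjoint A = A"
  shows "length (sorted_eigenvalues A) = n"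
    and "\<exists>P \<in> carrier_mat n n. mat_adjoint P * P = 1\<^sub>m n \<and>
           mat_adjoint P * A * P = mat_diag n (\<lambda>i. complex_of_real (sorted_eigenvalues A ! i))"
proof -
  obtain as where as: "char_poly A = (\<Prod>a\<leftarrow>as. [:- a, 1:])" "length as = n"
    using char_poly_factorized[OF A(1)] by blast
  from hermitian_unitary_diagonalization[OF A as(1)] obtain P
    where P: "P \<in> carrier_mat n n" "mat_adjoint P * A * P = mat_diag n ((!) as)" by blast
  have aP: "mat_adjoint P \<in> carrier_mat n n"
    using P by simp
  have "mat_adjoint (mat_adjoint P * A * P) = mat_adjoint P * A * P"
    using A P(1) aP by (simp add: mat_adjoint_mult[of _ n n _ n] assoc_mult_mat[of _ n n _ n _ n])
  hence diag_herm: "mat_adjoint (mat_diag n ((!) as)) = mat_diag n ((!) as)"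
    by (simp add: P)
  \<comment> \<open>A diagonal entry of a self-adjoint matrix equals its own conjugate.\<close>
  have "as ! i = complex_of_real (Re (as ! i))" if "i < n" for i
    using arg_cong[OF diag_herm, of "\<lambda>M. M $$ (i, i)"] that
    by (auto simp: mat_diag_def complex_eq_iff)
  hence "\<forall>a\<in>set as. complex_of_real (Re a) = a"
    using as(2) by (metis in_set_conv_nth)
  hence as_real: "image_mset (\<lambda>x. complex_of_real (Re x)) (mset as) = mset as"
    by (intro multiset.map_ident_strong) auto
  have "proots (char_poly A) = mset as"
    by (simp add: as(1) proots_linear_factors)
  hence mset_eigs: "mset (sorted_eigenvalues A) = image_mset Re (mset as)"
    by (simp add: sorted_eigenvalues_def)
  thus "length (sorted_eigenvalues A) = n"
    using as(2) by (metis size_image_mset size_mset)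
  define es where "es = map complex_of_real (sorted_eigenvalues A)"
  have "mset es = mset as"
    using as_real by (simp add: es_def mset_eigs image_mset.compositionality o_def)
  \<comment> \<open>The product of the linear factors depends only on the multiset of roots, so
    sorting does not change it.\<close>
  hence "(\<Prod>e\<leftarrow>es. [:- e, 1:]) = (\<Prod>a\<leftarrow>as. [:- a, 1:])"
    by (metis mset_map prod_mset_prod_list)
  with as(1) have "char_poly A = (\<Prod>e\<leftarrow>es. [:- e, 1:])" by simp
  moreover have "mat_diag n ((!) es) = mat_diag n (\<lambda>i. complex_of_real (sorted_eigenvalues A ! i))"
    using \<open>length (sorted_eigenvalues A) = n\<close> by (auto simp: es_def mat_diag_def)
  ultimately show "\<exists>P \<in> carrier_mat n n. mat_adjoint P * P = 1\<^sub>m n \<and>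
           mat_adjoint P * A * P = mat_diag n (\<lambda>i. complex_of_real (sorted_eigenvalues A ! i))"
    using hermitian_unitary_diagonalization[OF A] by metis
qed

section \<open>Bounds on the overlap from the eigenbasis expansion\<close>

theorem theorem7:
  fixes d :: nat and H :: "complex mat" and \<psi> \<phi> :: "complex vec" and \<Delta> :: real
  assumes "d \<ge> 2"
    and "H \<in> carrier_mat d d"
    and "self_adjoint H"
    and "positive_semidefinite H"
    and "smallest_eigenvalue H = 0"
    and "nondegenerate_eigenvalue H 0"
    and "eigenvector H \<psi> 0"
    and "unit_vector d \<psi>"
    and "\<Delta> = spectral_gap H"
    and "\<Delta> > 0"
    and "unit_vector d \<phi>"
    and "expectation H \<phi> < \<Delta>"
  shows "1 - expectation H \<phi> / \<Delta> \<le> (cmod (braket \<phi> \<psi>))\<^sup>2 \<and>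
         (cmod (braket \<phi> \<psi>))\<^sup>2 \<le> 1 - expectation H \<phi> / mat_trace H"
proof -
  have d: "d > 0" "1 < d" using assms(1) by auto
  note H = assms(2)
  have herm: "mat_adjoint H = H"
    using assms(3) by (simp add: self_adjoint_def)
  define e where "e i = sorted_eigenvalues H ! i" for i
  obtain P where P: "P \<in> carrier_mat d d" and PP: "mat_adjoint P * P = 1\<^sub>m d"
    and diag: "mat_adjoint P * H * P = mat_diag d (\<lambda>i. complex_of_real (e i))"
    using hermitian_unitary_diagonalization_sorted(2)[OF H herm] by (auto simp: e_def)
  have len: "length (sorted_eigenvalues H) = d"
    by (rule hermitian_unitary_diagonalization_sorted(1)[OF H herm])
  define Q where "Q = mat_adjoint P"
  have Q: "Q \<in> carrier_mat d d"
    using P by (simp add: Q_def)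
  have PQ: "P * Q = 1\<^sub>m d"
    using mat_mult_left_right_inverse[OF Q P] PP by (simp add: Q_def)
  define B where "B = mat_diag d (\<lambda>i. complex_of_real (e i))"
  have B: "B \<in> carrier_mat d d" by (simp add: B_def)
  have QHP: "Q * H * P = B"
    using diag by (simp add: Q_def B_def)
  have "P * (Q * H * P) * Q = (P * Q) * H * (P * Q)"
    using P Q H by (simp add: assoc_mult_mat[of _ d d _ d _ d])
  hence H_eq: "H = P * B * Q"
    using H by (simp add: QHP PQ)
  have Q_isometry: "(Q *\<^sub>v u) \<bullet>c (Q *\<^sub>v v) = u \<bullet>c v"
    if "u \<in> carrier_vec d" "v \<in> carrier_vec d" for u v
  proof -
    have "(Q *\<^sub>v u) \<bullet>c (Q *\<^sub>v v) = u \<bullet>c (P *\<^sub>v (Q *\<^sub>v v))"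
      using mult_mat_vec_cscalar_prod[OF Q, of u "Q *\<^sub>v v"] Q that by (simp add: Q_def)
    also have "P *\<^sub>v (Q *\<^sub>v v) = v"
      using assoc_mult_mat_vec[OF P Q that(2)] that by (simp add: PQ)
    finally show ?thesis .
  qed
  have QH: "Q *\<^sub>v (H *\<^sub>v v) = B *\<^sub>v (Q *\<^sub>v v)" if "v \<in> carrier_vec d" for v
  proof -
    have "B * Q = Q * H * (P * Q)"
      unfolding QHP[symmetric] using P Q H by (intro assoc_mult_mat) auto
    hence "Q * H = B * Q"
      using Q H by (simp add: PQ)
    thus ?thesis
      using assoc_mult_mat_vec[OF Q H that] assoc_mult_mat_vec[OF B Q that] by simp
  qed
  have B_index: "(B *\<^sub>v v) $ i = of_real (e i) * v $ i" if "v \<in> carrier_vec d" "i < d" for v i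
    using that
    by (auto simp: B_def mat_diag_def scalar_prod_def if_distrib if_distribR sum.delta cong: if_cong)

  define p s where "p = Q *\<^sub>v \<phi>" and "s = Q *\<^sub>v \<psi>"
  have \<phi>: "\<phi> \<in> carrier_vec d" "\<phi> \<bullet>c \<phi> = 1" and \<psi>: "\<psi> \<in> carrier_vec d" "\<psi> \<bullet>c \<psi> = 1"
    using assms(8,11) by (auto simp: unit_vector_def braket_def)
  have p: "p \<in> carrier_vec d" and s: "s \<in> carrier_vec d"
    using Q \<phi> \<psi> by (auto simp: p_def s_def)
  define w where "w i = cmod (p $ i) * cmod (p $ i)" for i
  have cmod_sq: "complex_of_real (cmod z) * complex_of_real (cmod z) = z * cnj z" for z
    using complex_norm_square[of z] by (simp add: power2_eq_square)
  have "p \<bullet>c p = 1"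
    using Q_isometry[OF \<phi>(1) \<phi>(1)] \<phi> by (simp add: p_def)
  moreover have "p \<bullet>c p = complex_of_real (\<Sum>i<d. w i)"
    using p by (auto simp: scalar_prod_def w_def lessThan_atLeast0 cmod_sq intro!: sum.cong)
  ultimately have w_sum: "(\<Sum>i<d. w i) = 1"
    by (metis of_real_eq_1_iff)
  have "(H *\<^sub>v \<phi>) \<bullet>c \<phi> = (B *\<^sub>v p) \<bullet>c p"
    using Q_isometry[of "H *\<^sub>v \<phi>" \<phi>] H \<phi> QH by (simp add: p_def)
  also have "\<dots> = complex_of_real (\<Sum>i<d. e i * w i)"
    using p B B_index[OF p]
    by (auto simp: scalar_prod_def w_def lessThan_atLeast0 cmod_sq mult.assoc
        simp del: index_mult_mat_vec intro!: sum.cong)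
  finally have E: "expectation H \<phi> = (\<Sum>i<d. e i * w i)"
    by (simp add: expectation_def braket_def)

  have e0: "e 0 = 0"
    using assms(5) by (simp add: smallest_eigenvalue_def e_def)
  \<comment> \<open>The smallest eigenvalue is 0, so the gap is the second smallest eigenvalue
    itself.\<close>
  have e1: "e 1 = \<Delta>"
    using assms(5,9) by (simp add: spectral_gap_def second_smallest_eigenvalue_def e_def)
  have e_mono: "e i \<le> e j" if "i \<le> j" "j < d" for i j
    using that len sorted_nth_mono[of "sorted_eigenvalues H" i j]
    by (simp add: e_def sorted_eigenvalues_def)
  have e_gap: "e i \<ge> \<Delta>" if "i \<in> {..<d} - {0}" for i
    using e_mono[of 1 i] that e1 by auto
  have e_nonneg: "e i \<ge> 0" if "i < d" for i
    using e_mono[of 0 i] that e0 by simp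

  \<comment> \<open>From \<open>H\<close> annihilating \<psi> it follows that
    \<open>e i * s $ i = 0\<close>, and \<open>e i\<close> is at least \<Delta> > 0 away from index
    0. So \<psi> lies along the first basis vector.\<close>
  have s_zero: "s $ i = 0" if "i < d" "i \<noteq> 0" for i
  proof -
    have "H *\<^sub>v \<psi> = 0\<^sub>v d"
      using assms(7) H \<psi> by (auto simp: eigenvector_def)
    moreover have "Q *\<^sub>v 0\<^sub>v d = 0\<^sub>v d"
      using Q by (intro eq_vecI) auto
    ultimately have "B *\<^sub>v s = 0\<^sub>v d"
      using QH[OF \<psi>(1)] by (simp add: s_def)
    hence "of_real (e i) * s $ i = 0"
      using B_index[OF s that(1)] that by simp
    thus ?thesis
      using e_gap[of i] that assms(10) by auto
  qed
  have s_cscalar: "s \<bullet>c v = s $ 0 * cnj (v $ 0)" if "v \<in> carrier_vec d" for v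
  proof -
    have "s \<bullet>c v = (\<Sum>i<d. s $ i * cnj (v $ i))"
      using that by (auto simp: scalar_prod_def lessThan_atLeast0 intro!: sum.cong)
    also have "\<dots> = (\<Sum>i\<in>{0}. s $ i * cnj (v $ i))"
      using d s_zero by (intro sum.mono_neutral_right) auto
    finally show ?thesis by simp
  qed
  \<comment> \<open>Being a unit vector, \<psi> equals the first basis vector up to a phase, which
    disappears from the modulus of the overlap.\<close>
  have "s $ 0 * cnj (s $ 0) = 1"
    using Q_isometry[OF \<psi>(1) \<psi>(1)] \<psi> s_cscalar[OF s] by (simp add: s_def)
  hence "complex_of_real ((cmod (s $ 0))\<^sup>2) = 1"
    by (simp only: complex_norm_square)
  hence s0: "(cmod (s $ 0))\<^sup>2 = 1"
    by (metis of_real_eq_1_iff)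
  have "braket \<phi> \<psi> = s $ 0 * cnj (p $ 0)"
    using Q_isometry[OF \<psi>(1) \<phi>(1)] s_cscalar[OF p] by (simp add: braket_def s_def p_def)
  hence overlap: "(cmod (braket \<phi> \<psi>))\<^sup>2 = w 0"
    using s0 by (simp add: norm_mult power_mult_distrib w_def power2_eq_square)

  \<comment> \<open>Cyclicity of the trace moves \<open>Q\<close> to the front, where it cancels
    \<open>P\<close> and leaves the sum of the eigenvalues.\<close>
  have "(\<Sum>i<d. H $$ (i, i)) = (\<Sum>i<d. (Q * (P * B)) $$ (i, i))"
    unfolding H_eq using trace_mult_commute[of "P * B" d d Q] P Q B by simp
  also have "Q * (P * B) = B"
    using assoc_mult_mat[OF Q P B] PP B by (simp add: Q_def)
  also have "(\<Sum>i<d. B $$ (i, i)) = complex_of_real (\<Sum>i<d. e i)"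
    by (simp add: B_def mat_diag_def)
  finally have Tr: "mat_trace H = (\<Sum>i<d. e i)"
    using H by (simp add: mat_trace_def)
  \<comment> \<open>One summand is at most the whole sum, since all eigenvalues are
    non-negative.\<close>
  have e_le_Tr: "e i \<le> mat_trace H" if "i < d" for i
    unfolding Tr using that e_nonneg by (intro member_le_sum) auto
  \<comment> \<open>Index 1 exists because \<open>d\<close> is at least 2, and its eigenvalue is
    \<Delta>; so dividing by the trace at the end is legitimate.\<close>
  have Tr_pos: "mat_trace H > 0"
    using e_le_Tr[of 1] d e1 assms(10) by simp

  have w_nonneg: "w i \<ge> 0" for i
    by (simp add: w_def)
  have w_rest: "(\<Sum>i\<in>{..<d} - {0}. w i) = 1 - w 0"
    using w_sum d by (simp add: sum.remove[of "{..<d}" 0])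
  \<comment> \<open>The term at index 0 vanishes because \<open>e 0 = 0\<close>; both bounds then
    compare the remaining sum term by term.\<close>
  have E': "expectation H \<phi> = (\<Sum>i\<in>{..<d} - {0}. e i * w i)"
    unfolding E using d e0 by (simp add: sum.remove[of "{..<d}" 0])
  have "\<Delta> * (1 - w 0) \<le> expectation H \<phi>"
    unfolding E' w_rest[symmetric] sum_distrib_left
    by (intro sum_mono mult_right_mono e_gap w_nonneg)
  moreover have "expectation H \<phi> \<le> mat_trace H * (1 - w 0)"
    unfolding E' w_rest[symmetric] sum_distrib_left
    by (intro sum_mono mult_right_mono e_le_Tr w_nonneg) auto
  ultimately show ?thesis
    using assms(10) Tr_pos unfolding overlap by (auto simp: field_simps)
qed

end
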